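(* Let $f:[0,1]\to[0,1]$ be continuous and suppose $f$ has a periodic orbit $O$ of period $n$. Then there exists a set $S\subset[0,1]$ of $n-1$ points such that $f$ permutes $S$ (i.e. $f$ restricts to a bijection of $S$ onto itself) and $S$ interwinds $O$.
   Context: A set $S$ of $n-1$ points on the real line is said to interwind a set $O$ of $n$ points if any two consecutive points of either of these two sets are separated by a point of the other set; i.e. between any two consecutive points of $O$ there lies (strictly) a point of $S$, and between any two consecutive points of $S$ there lies (strictly) a point of $O$. A periodic orbit of period $n$ is a set of $n$ distinct points cyclically permuted by $f$. *)

theory Defs
  imports "HOL-Analysis.Analysis" "HOL-Combinatorics.Orbits"
begin

(* cyclic_on f A says that A is the forward orbit of one of its own points under at least
   one application of f; this makes A finite and nonempty, with f permuting it in a single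
   cycle.  In particular n > 0. *)
definition periodic_orbit :: "('a \<Rightarrow> 'a) \<Rightarrow> nat \<Rightarrow> 'a set \<Rightarrow> bool" where
  "periodic_orbit f n A \<longleftrightarrow> cyclic_on f A \<and> card A = n"

definition consecutive_in :: "real set \<Rightarrow> real \<Rightarrow> real \<Rightarrow> bool" where
  "consecutive_in A a b \<longleftrightarrow> a \<in> A \<and> b \<in> A \<and> a < b \<and> A \<inter> {a<..<b} = {}"

definition separated_by :: "real set \<Rightarrow> real set \<Rightarrow> bool" where
  "separated_by A B \<longleftrightarrow> (\<forall>a b. consecutive_in A a b \<longrightarrow> (\<exists>c\<in>B. a < c \<and> c < b))"

definition interwinds :: "real set \<Rightarrow> real set \<Rightarrow> bool" where
  "interwinds S A \<longleftrightarrow> finite S \<and> finite A \<and> card A = card S + 1 \<and>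
     separated_by A S \<and> separated_by S A"

end

theory Submission
  imports Defs "Jordan_Normal_Form.Determinant"
begin

text \<open>
  Let \<open>x\<^sub>0 < \<dots> < x\<^sub>m\<close> be the points of the orbit, so \<open>n = m + 1\<close>, and let \<open>\<pi>\<close> be the
  permutation of the indices with \<open>f x\<^sub>i = x\<^bsub>\<pi> i\<^esub>\<close>.  The set sought has to consist of one point
  from each of the \<open>m\<close> gaps \<open>(x\<^sub>i, x\<^bsub>i+1\<^esub>)\<close>, and \<open>f\<close> has to permute these points, so the
  gaps have to be permuted first.

  By the intermediate value theorem the image of gap \<open>i\<close> contains gap \<open>j\<close> as soon as gap \<open>j\<close>
  lies between \<open>x\<^bsub>\<pi> i\<^esub>\<close> and \<open>x\<^bsub>\<pi> (i+1)\<^esub>\<close>.  Record this by a matrix with entry \<open>1\<close> or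
  \<open>-1\<close>, according to the direction in which the gap is crossed, and \<open>0\<close> if it is not crossed.
  This matrix describes the action of \<open>\<pi>\<close> on the group of integer combinations of
  \<open>x\<^sub>0, \<dots>, x\<^sub>m\<close> with coefficient sum \<open>0\<close>, in the basis \<open>x\<^bsub>i+1\<^esub> - x\<^sub>i\<close>.  Hence it is
  invertible, its determinant does not vanish, and some term of the Leibniz expansion is
  nonzero.  That term is a permutation \<open>\<sigma>\<close> of the gaps such that every gap \<open>i\<close> covers
  gap \<open>\<sigma> i\<close> (lemma \<open>crossing_gap_permutation\<close>).

  Each cycle of \<open>\<sigma>\<close> is a loop of closed intervals in which each one covers the next.  Such a
  loop is followed by a periodic point of \<open>f\<close>, so there are points \<open>y\<^sub>i\<close> in the closed gaps
  with \<open>f y\<^sub>i = y\<^bsub>\<sigma> i\<^esub>\<close> (lemma \<open>permutation_of_intervals\<close>).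

  None of the \<open>y\<^sub>i\<close> is an endpoint of its gap: otherwise the whole orbit, having \<open>m + 1\<close>
  points, would be contained in the \<open>f\<close>-invariant set of the at most \<open>m\<close> points \<open>y\<^sub>i\<close>.
  Therefore the \<open>y\<^sub>i\<close> strictly alternate with the \<open>x\<^sub>i\<close>, which is interwinding.
\<close>

section \<open>A permutation of the gaps\<close>

text \<open>
  The signed number of times that a walk from \<open>p\<close> to \<open>q\<close> passes from \<open>j\<close> to \<open>j + 1\<close>.
\<close>

definition crossing :: "nat \<Rightarrow> nat \<Rightarrow> nat \<Rightarrow> int" where
  "crossing p q j = of_bool (j < q) - of_bool (j < p)"

lemma crossing_nonzero_iff:
  "crossing p q j \<noteq> 0 \<longleftrightarrow> p \<le> j \<and> j < q \<or> q \<le> j \<and> j < p"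
  by (auto simp: crossing_def)

text \<open>
  The increments of \<open>g\<close> along a walk from \<open>p\<close> to \<open>q\<close> add up to \<open>g q - g p\<close>.  In this form
  the sum is the product of a row of crossing numbers with a column of increments, which is
  how it arises when two crossing matrices are multiplied.
\<close>

lemma sum_crossing_telescope:
  fixes g :: "nat \<Rightarrow> int"
  assumes "p \<le> m" "q \<le> m"
  shows "(\<Sum>j<m. crossing p q j * (g (Suc j) - g j)) = g q - g p"
proof -
  have part: "(\<Sum>j<m. of_bool (j < r) * (g (Suc j) - g j)) = g r - g 0" if "r \<le> m" for r
  proof -
    have "(\<Sum>j<m. of_bool (j < r) * (g (Suc j) - g j)) = (\<Sum>j<r. g (Suc j) - g j)"
      using that by (intro sum.mono_neutral_cong_right) auto
    then show ?thesis by (simp add: sum_lessThan_telescope)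
  qed
  show ?thesis
    using part[OF assms(1)] part[OF assms(2)]
    by (simp add: crossing_def left_diff_distrib sum_subtractf)
qed

text \<open>
  The crossing matrices of \<open>\<pi>\<close> and of its inverse multiply to the identity, so the first has a
  nonzero determinant, and \<open>\<sigma>\<close> is read off from a nonzero term of the Leibniz expansion.
\<close>

lemma crossing_gap_permutation:
  fixes \<pi> :: "nat \<Rightarrow> nat"
  assumes inj: "inj_on \<pi> {..m}" and into: "\<pi> ` {..m} \<subseteq> {..m}"
  obtains \<sigma> where "\<sigma> permutes {..<m}"
    and "\<And>i. i < m \<Longrightarrow> crossing (\<pi> i) (\<pi> (Suc i)) (\<sigma> i) \<noteq> 0"
proof -
  define \<tau> where "\<tau> = inv_into {..m} \<pi>"
  have \<tau>: "\<tau> (\<pi> i) = i" if "i \<le> m" for i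
    using inj that by (simp add: \<tau>_def)
  define M :: "(nat \<Rightarrow> nat) \<Rightarrow> int mat"
    where "M \<rho> = Matrix.mat m m (\<lambda>(i, j). crossing (\<rho> i) (\<rho> (Suc i)) j)" for \<rho>
  have carrier: "M \<rho> \<in> carrier_mat m m" for \<rho>
    by (simp add: M_def)
  have "M \<pi> * M \<tau> = 1\<^sub>m m"
  proof (rule eq_matI)
    fix i k assume "i < dim_row (1\<^sub>m m :: int mat)" "k < dim_col (1\<^sub>m m :: int mat)"
    then have ik: "i < m" "k < m" by auto
    \<comment> \<open>Column \<open>k\<close> of \<open>M \<tau>\<close> consists of the increments of this step function.\<close>
    let ?g = "\<lambda>j. of_bool (k < \<tau> j) :: int"
    have "(M \<pi> * M \<tau>) $$ (i, k)
        = (\<Sum>j<m. crossing (\<pi> i) (\<pi> (Suc i)) j * crossing (\<tau> j) (\<tau> (Suc j)) k)"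
      using ik by (simp add: M_def scalar_prod_def atLeast0LessThan)
    also have "\<dots> = (\<Sum>j<m. crossing (\<pi> i) (\<pi> (Suc i)) j * (?g (Suc j) - ?g j))"
      by (simp add: crossing_def)
    also have "\<dots> = ?g (\<pi> (Suc i)) - ?g (\<pi> i)"
      using into ik by (intro sum_crossing_telescope) (auto simp: image_subset_iff)
    \<comment> \<open>As \<open>\<tau>\<close> inverts \<open>\<pi>\<close>, this difference is \<open>of_bool (k < i + 1) - of_bool (k < i)\<close>.\<close>
    also have "\<dots> = (1\<^sub>m m :: int mat) $$ (i, k)"
      using ik \<tau>[of i] \<tau>[of "Suc i"] by auto
    finally show "(M \<pi> * M \<tau>) $$ (i, k) = (1\<^sub>m m) $$ (i, k)" .
  qed (auto simp: M_def)
  then have "Determinant.det (M \<pi>) * Determinant.det (M \<tau>) = 1"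
    by (metis carrier det_mult det_one)
  then have "Determinant.det (M \<pi>) \<noteq> 0" by auto
  then obtain \<sigma> where \<sigma>: "\<sigma> permutes {0..<m}"
    and nz: "signof \<sigma> * (\<Prod>i = 0..<m. M \<pi> $$ (i, \<sigma> i)) \<noteq> 0"
    unfolding det_def'[OF carrier] by (metis (mono_tags, lifting) mem_Collect_eq sum.neutral)
  show thesis
  proof
    show "\<sigma> permutes {..<m}" using \<sigma> by (simp add: atLeast0LessThan)
    fix i assume "i < m"
    moreover have "\<sigma> i < m" using permutes_in_image[OF \<sigma>, of i] \<open>i < m\<close> by simp
    moreover have "M \<pi> $$ (i, \<sigma> i) \<noteq> 0" using nz \<open>i < m\<close> by auto
    ultimately show "crossing (\<pi> i) (\<pi> (Suc i)) (\<sigma> i) \<noteq> 0" by (simp add: M_def)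
  qed
qed

section \<open>Loops of intervals\<close>

text \<open>
  If \<open>g\<close> rises from below \<open>u\<close> to above \<open>v\<close>, let \<open>c\<close> be the last time it takes the value \<open>u\<close>
  and \<open>d\<close> the first later time it takes the value \<open>v\<close>; in between it cannot leave
  \<open>{u..v}\<close>, since it would have to return through \<open>u\<close> or have passed through \<open>v\<close>.  The
  falling case follows by applying this to \<open>- g\<close>.
\<close>

lemma tight_subinterval:
  fixes g :: "real \<Rightarrow> real"
  assumes cont: "continuous_on {a..b} g" and ab: "a \<le> b" and uv: "u \<le> v"
    and cover: "{u..v} \<subseteq> closed_segment (g a) (g b)"
  obtains c d where "a \<le> c" "c \<le> d" "d \<le> b" "g ` {c..d} \<subseteq> {u..v}" "{g c, g d} = {u, v}"
proof -
  have increasing: "\<exists>c d. a \<le> c \<and> c \<le> d \<and> d \<le> b \<and> h ` {c..d} \<subseteq> {p..q} \<and> h c = p \<and> h d = q"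
    if h: "continuous_on {a..b} h" and pq: "h a \<le> p" "p \<le> q" "q \<le> h b" for h :: "real \<Rightarrow> real" and p q
  proof -
    have comp: "compact {t \<in> {s..b}. h t = y}" if "a \<le> s" for s y
    proof -
      have "continuous_on {s..b} h" using h that by (auto intro: continuous_on_subset)
      then have "closed {t \<in> {s..b}. h t = y}" by (intro continuous_closed_preimage_constant) auto
      then have "compact ({s..b} \<inter> {t \<in> {s..b}. h t = y})" by (intro compact_Int_closed) auto
      moreover have "{s..b} \<inter> {t \<in> {s..b}. h t = y} = {t \<in> {s..b}. h t = y}" by auto
      ultimately show ?thesis by simp
    qed
    have ivt: "\<exists>t. s \<le> t \<and> t \<le> s' \<and> h t = y" if "a \<le> s" "s \<le> s'" "s' \<le> b" "h s \<le> y" "y \<le> h s'" for s s' y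
      using that by (intro IVT' continuous_on_subset[OF h]) auto
    have "{t \<in> {a..b}. h t = p} \<noteq> {}" using ivt[of a b p] ab pq by auto
    then obtain c where c: "a \<le> c" "c \<le> b" "h c = p"
      and c_last: "\<And>t. a \<le> t \<Longrightarrow> t \<le> b \<Longrightarrow> h t = p \<Longrightarrow> t \<le> c"
      using compact_attains_sup[OF comp[of a p]] by auto
    have "{t \<in> {c..b}. h t = q} \<noteq> {}" using ivt[of c b q] c pq by auto
    then obtain d where d: "c \<le> d" "d \<le> b" "h d = q"
      and d_first: "\<And>t. c \<le> t \<Longrightarrow> t \<le> b \<Longrightarrow> h t = q \<Longrightarrow> d \<le> t"
      using compact_attains_inf[OF comp[of c q]] c by auto
    have "p \<le> h t \<and> h t \<le> q" if t: "c \<le> t" "t \<le> d" for t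
    proof (rule ccontr)
      assume "\<not> ?thesis"
      then consider "h t < p" | "h t > q" by linarith
      then show False
      proof cases
        case 1
        then obtain s where "t \<le> s" "s \<le> d" "h s = p" using ivt[of t d p] t c d pq by auto
        with c_last[of s] t c d have "t = c" by auto
        with 1 c show False by auto
      next
        case 2
        then obtain s where "c \<le> s" "s \<le> t" "h s = q" using ivt[of c t q] t c d pq by auto
        with d_first[of s] t c d have "t = d" by auto
        with 2 d show False by auto
      qed
    qed
    with c d show ?thesis by (intro exI[of _ c] exI[of _ d]) auto
  qed
  have "g a \<le> u \<and> v \<le> g b \<or> g b \<le> u \<and> v \<le> g a"
    using cover uv by (auto simp: closed_segment_eq_real_ivl split: if_splits)
  then show thesis
  proof
    assume "g a \<le> u \<and> v \<le> g b"
    then show thesis using increasing[OF cont, of u v] uv that by blast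
  next
    assume "g b \<le> u \<and> v \<le> g a"
    then have "\<exists>c d. a \<le> c \<and> c \<le> d \<and> d \<le> b \<and> (\<lambda>t. - g t) ` {c..d} \<subseteq> {-v..-u} \<and> - g c = -v \<and> - g d = -u"
      using uv by (intro increasing continuous_on_minus cont) auto
    then obtain c d where cd: "a \<le> c" "c \<le> d" "d \<le> b" "(\<lambda>t. - g t) ` {c..d} \<subseteq> {-v..-u}" "g c = v" "g d = u"
      by auto
    then have "g ` {c..d} \<subseteq> {u..v}" by (auto simp: image_subset_iff)
    with cd show thesis by (intro that[of c d]) auto
  qed
qed

text \<open>
  Only the positions of the images of the two endpoints matter for the next covering step.
  So the induction keeps track of an interval whose endpoints \<open>f ^^ k\<close> sends exactly to those
  of the \<open>k\<close>-th interval, in either order.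
\<close>

lemma itinerary_subinterval:
  fixes f :: "real \<Rightarrow> real" and l r :: "nat \<Rightarrow> real"
  assumes lr: "\<And>j. l j \<le> r j" and cont: "\<And>j. continuous_on {l j..r j} f"
    and cover: "\<And>j. {l (Suc j)..r (Suc j)} \<subseteq> closed_segment (f (l j)) (f (r j))"
  shows "\<exists>c d. l 0 \<le> c \<and> c \<le> d \<and> d \<le> r 0 \<and> continuous_on {c..d} (f ^^ k) \<and>
    (\<forall>j\<le>k. (f ^^ j) ` {c..d} \<subseteq> {l j..r j}) \<and> {(f ^^ k) c, (f ^^ k) d} = {l k, r k}"
proof (induction k)
  case 0
  show ?case
    using lr[of 0] by (intro exI[of _ "l 0"] exI[of _ "r 0"]) auto
next
  case (Suc k)
  then obtain a b where ab: "l 0 \<le> a" "a \<le> b" "b \<le> r 0" "continuous_on {a..b} (f ^^ k)"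
    and itin: "\<And>j. j \<le> k \<Longrightarrow> (f ^^ j) ` {a..b} \<subseteq> {l j..r j}"
    and ends: "{(f ^^ k) a, (f ^^ k) b} = {l k, r k}"
    by blast
  have cont': "continuous_on {a..b} (f ^^ Suc k)"
    using continuous_on_compose[OF ab(4) continuous_on_subset[OF cont[of k] itin[of k]]] by simp
  have "closed_segment ((f ^^ Suc k) a) ((f ^^ Suc k) b) = closed_segment (f (l k)) (f (r k))"
    using ends closed_segment_commute unfolding doubleton_eq_iff by auto
  then have "{l (Suc k)..r (Suc k)} \<subseteq> closed_segment ((f ^^ Suc k) a) ((f ^^ Suc k) b)"
    using cover[of k] by (simp only:)
  from tight_subinterval[OF cont' ab(2) lr this]
  obtain c d where cd: "a \<le> c" "c \<le> d" "d \<le> b" "(f ^^ Suc k) ` {c..d} \<subseteq> {l (Suc k)..r (Suc k)}"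
    "{(f ^^ Suc k) c, (f ^^ Suc k) d} = {l (Suc k), r (Suc k)}" by blast
  have sub: "{c..d} \<subseteq> {a..b}" using cd by auto
  have "(f ^^ j) ` {c..d} \<subseteq> {l j..r j}" if "j \<le> Suc k" for j
  proof (cases "j = Suc k")
    case True then show ?thesis using cd(4) by simp
  next
    case False
    then have "(f ^^ j) ` {a..b} \<subseteq> {l j..r j}" using that itin by simp
    then show ?thesis using sub by blast
  qed
  then show ?case
    using ab cd sub cont' by (intro exI[of _ c] exI[of _ d]) (auto intro: continuous_on_subset simp del: funpow.simps)
qed

text \<open>
  On the interval that follows a loop of length \<open>k\<close>, the iterate \<open>f ^^ k\<close> sends the endpoints
  to those of an interval containing it, hence \<open>f ^^ k\<close> minus the identity changes sign there.
\<close>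

lemma loop_periodic_point:
  fixes f :: "real \<Rightarrow> real" and l r :: "nat \<Rightarrow> real"
  assumes lr: "\<And>j. l j \<le> r j" and cont: "\<And>j. continuous_on {l j..r j} f"
    and cover: "\<And>j. {l (Suc j)..r (Suc j)} \<subseteq> closed_segment (f (l j)) (f (r j))"
    and loop: "l k = l 0" "r k = r 0"
  obtains z where "(f ^^ k) z = z" "\<And>j. j \<le> k \<Longrightarrow> (f ^^ j) z \<in> {l j..r j}"
proof -
  obtain c d where cd: "l 0 \<le> c" "c \<le> d" "d \<le> r 0" "continuous_on {c..d} (f ^^ k)"
    and itin: "\<And>j. j \<le> k \<Longrightarrow> (f ^^ j) ` {c..d} \<subseteq> {l j..r j}"
    and ends: "{(f ^^ k) c, (f ^^ k) d} = {l 0, r 0}"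
    using itinerary_subinterval[of l r f k, OF lr cont cover] loop by auto
  let ?h = "\<lambda>t. (f ^^ k) t - t"
  have h: "continuous_on {c..d} ?h" using cd by (intro continuous_intros)
  have "\<exists>z. c \<le> z \<and> z \<le> d \<and> ?h z = 0"
  proof (cases "(f ^^ k) c = l 0 \<and> (f ^^ k) d = r 0")
    case True
    then show ?thesis using cd by (intro IVT' h) auto
  next
    case False
    then have "(f ^^ k) c = r 0 \<and> (f ^^ k) d = l 0" using ends by (auto simp: doubleton_eq_iff)
    then show ?thesis using cd by (intro IVT2' h) auto
  qed
  then obtain z where z: "c \<le> z" "z \<le> d" "(f ^^ k) z = z" by auto
  show thesis
    using z itin by (intro that[of z]) (auto simp: image_subset_iff)
qed

text \<open>
  Going round the cycle from one of its elements gives a loop of intervals.  The points are the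
  successive images of a periodic point of that loop, and its periodicity is what makes the last
  image fit the first point.
\<close>

lemma cycle_of_intervals:
  fixes f :: "real \<Rightarrow> real" and a b :: "'i \<Rightarrow> real"
  assumes cyc: "cyclic_on \<sigma> C"
    and ab: "\<And>i. i \<in> C \<Longrightarrow> a i \<le> b i" and cont: "\<And>i. i \<in> C \<Longrightarrow> continuous_on {a i..b i} f"
    and cover: "\<And>i. i \<in> C \<Longrightarrow> {a (\<sigma> i)..b (\<sigma> i)} \<subseteq> closed_segment (f (a i)) (f (b i))"
  shows "\<exists>y. \<forall>i\<in>C. y i \<in> {a i..b i} \<and> f (y i) = y (\<sigma> i)"
proof -
  obtain s where s: "s \<in> C" "C = orbit \<sigma> s" using cyc by (auto simp: cyclic_on_def)
  define k where "k = funpow_dist1 \<sigma> s s"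
  let ?e = "\<lambda>j. (\<sigma> ^^ j) s"
  have self: "s \<in> orbit \<sigma> s" using s by simp
  have k: "k > 0" "?e k = s"
    unfolding k_def using funpow_dist1_prop[OF self] by auto
  have C: "C = ?e ` {0..<k}" and inj: "inj_on ?e {0..<k}"
    unfolding k_def using orbit_conv_funpow_dist1[OF self] inj_on_funpow_dist1[OF self] s(2) by auto
  have eC: "?e j \<in> C" for j using cyclic_on_funpow_in[OF cyc s(1)] .
  obtain z where z: "(f ^^ k) z = z" "\<And>j. j \<le> k \<Longrightarrow> (f ^^ j) z \<in> {a (?e j)..b (?e j)}"
  proof (rule loop_periodic_point[of "\<lambda>j. a (?e j)" "\<lambda>j. b (?e j)" f k])
    show "{a (?e (Suc j))..b (?e (Suc j))} \<subseteq> closed_segment (f (a (?e j))) (f (b (?e j)))" for j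
      using cover[OF eC[of j]] by simp
  qed (use ab cont eC k that in auto)
  define y where "y i = (f ^^ the_inv_into {0..<k} ?e i) z" for i
  have y: "y (?e j) = (f ^^ j) z" if "j < k" for j
    using the_inv_into_f_f[OF inj, of j] that by (simp add: y_def)
  have "y (?e j) \<in> {a (?e j)..b (?e j)} \<and> f (y (?e j)) = y (\<sigma> (?e j))" if j: "j < k" for j
  \<comment> \<open>The last step of the loop leads back to \<open>s\<close>, where \<open>y\<close> takes the value \<open>z\<close> itself.\<close>
  proof (cases "Suc j = k")
    case True
    then have "\<sigma> (?e j) = ?e 0" "f ((f ^^ j) z) = z" using k(2) z(1) by auto
    then show ?thesis using y[of 0] y[OF j] z(2)[of j] j k by simp
  next
    case False
    then show ?thesis using y[of "Suc j"] y[OF j] z(2)[of j] j by simp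
  qed
  then show ?thesis unfolding C by (intro exI[of _ y]) auto
qed

text \<open>
  Different cycles do not interact, so the points found for each of them can be put together.
  Choosing a family \<open>Y C\<close> for each cycle \<open>C\<close>, not for each element, makes the choices at
  \<open>i\<close> and at \<open>\<sigma> i\<close> agree.
\<close>

lemma permutation_of_intervals:
  fixes f :: "real \<Rightarrow> real" and a b :: "'i \<Rightarrow> real"
  assumes \<sigma>: "\<sigma> permutes I" "finite I"
    and ab: "\<And>i. i \<in> I \<Longrightarrow> a i \<le> b i" and cont: "\<And>i. i \<in> I \<Longrightarrow> continuous_on {a i..b i} f"
    and cover: "\<And>i. i \<in> I \<Longrightarrow> {a (\<sigma> i)..b (\<sigma> i)} \<subseteq> closed_segment (f (a i)) (f (b i))"
  obtains y where "\<And>i. i \<in> I \<Longrightarrow> y i \<in> {a i..b i}" "\<And>i. i \<in> I \<Longrightarrow> f (y i) = y (\<sigma> i)"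
proof -
  have "\<exists>y. \<forall>i\<in>orbit \<sigma> s. y i \<in> {a i..b i} \<and> f (y i) = y (\<sigma> i)" if "s \<in> I" for s
    using permutes_orbit_subset[OF \<sigma>(1) that] cyclic_on_orbit[OF \<sigma>]
    by (intro cycle_of_intervals ab cont cover) auto
  then obtain Y where "\<forall>C\<in>orbit \<sigma> ` I. \<forall>i\<in>C. Y C i \<in> {a i..b i} \<and> f (Y C i) = Y C (\<sigma> i)"
    using bchoice[of "orbit \<sigma> ` I" "\<lambda>C y. \<forall>i\<in>C. y i \<in> {a i..b i} \<and> f (y i) = y (\<sigma> i)"] by blast
  then have Y: "\<And>s i. s \<in> I \<Longrightarrow> i \<in> orbit \<sigma> s \<Longrightarrow>
      Y (orbit \<sigma> s) i \<in> {a i..b i} \<and> f (Y (orbit \<sigma> s) i) = Y (orbit \<sigma> s) (\<sigma> i)"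
    by blast
  have perm: "permutation \<sigma>" using \<sigma> by (auto simp: permutation_permutes)
  show thesis
    by (rule that[of "\<lambda>i. Y (orbit \<sigma> i) i"])
      (use Y permutation_self_in_orbit[OF perm] permutation_orbit_step[OF perm] in auto)
qed

section \<open>Interwinding\<close>

lemma consecutive_in_image_strict_mono:
  assumes mono: "strict_mono_on {..<n} x" and cons: "consecutive_in (x ` {..<n}) s t"
  obtains i where "Suc i < n" "s = x i" "t = x (Suc i)"
proof -
  obtain i j where ij: "i < n" "j < n" "s = x i" "t = x j"
    using cons by (auto simp: consecutive_in_def)
  have less: "x p < x q \<longleftrightarrow> p < q" if "p < n" "q < n" for p q
    using strict_mono_on_less[OF mono] that by simp
  have "i < j" using cons ij less by (simp add: consecutive_in_def)
  moreover have "\<not> Suc i < j"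
  proof
    assume "Suc i < j"
    then have "x (Suc i) \<in> x ` {..<n} \<inter> {s<..<t}" using ij less by auto
    then show False using cons by (auto simp: consecutive_in_def)
  qed
  ultimately have "j = Suc i" by simp
  then show thesis using that ij by simp
qed

lemma interleaved_interwinds:
  assumes xy: "\<And>i. i < m \<Longrightarrow> x i < y i" and yx: "\<And>i. i < m \<Longrightarrow> y i < x (Suc i)"
    and x: "strict_mono_on {..<Suc m} x"
  shows "card (y ` {..<m}) = m" "interwinds (y ` {..<m}) (x ` {..<Suc m})"
proof -
  have y: "strict_mono_on {..<m} y"
  proof (rule strict_mono_onI)
    fix i j assume ij: "i \<in> {..<m}" "j \<in> {..<m}" "i < j"
    then have "x (Suc i) \<le> x j" using strict_mono_on_leD[OF x, of "Suc i" j] by auto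
    then show "y i < y j" using xy[of j] yx[of i] ij by auto
  qed
  show cy: "card (y ` {..<m}) = m"
    using card_image[OF strict_mono_on_imp_inj_on[OF y]] by simp
  have cx: "card (x ` {..<Suc m}) = Suc m"
    using card_image[OF strict_mono_on_imp_inj_on[OF x]] by simp
  have "separated_by (x ` {..<Suc m}) (y ` {..<m})"
    unfolding separated_by_def
  proof (intro allI impI)
    fix s t assume "consecutive_in (x ` {..<Suc m}) s t"
    from consecutive_in_image_strict_mono[OF x this]
    obtain i where i: "Suc i < Suc m" "s = x i" "t = x (Suc i)" .
    then show "\<exists>c\<in>y ` {..<m}. s < c \<and> c < t"
      using xy[of i] yx[of i] by (intro bexI[of _ "y i"]) auto
  qed
  moreover have "separated_by (y ` {..<m}) (x ` {..<Suc m})"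
    unfolding separated_by_def
  proof (intro allI impI)
    fix s t assume "consecutive_in (y ` {..<m}) s t"
    from consecutive_in_image_strict_mono[OF y this]
    obtain i where i: "Suc i < m" "s = y i" "t = y (Suc i)" .
    then show "\<exists>c\<in>x ` {..<Suc m}. s < c \<and> c < t"
      using yx[of i] xy[of "Suc i"] by (intro bexI[of _ "x (Suc i)"]) auto
  qed
  ultimately show "interwinds (y ` {..<m}) (x ` {..<Suc m})"
    using cx cy by (simp add: interwinds_def)
qed

theorem theoremB:
  fixes f :: "real \<Rightarrow> real" and n :: nat and Orb :: "real set"
  assumes "continuous_on {0..1} f"
    and "f ` {0..1} \<subseteq> {0..1}"
    and "Orb \<subseteq> {0..1}"
    and "periodic_orbit f n Orb"
  shows "\<exists>S. S \<subseteq> {0..1} \<and> finite S \<and> card S = n - 1 \<and> bij_betw f S S \<and> interwinds S Orb"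
proof -
  have cyc: "cyclic_on f Orb" and card: "card Orb = n"
    using assms(4) by (auto simp: periodic_orbit_def)
  have fin: "finite Orb" and ne: "Orb \<noteq> {}"
    using finite_cyclic_on[OF cyc] cyc by (auto simp: cyclic_on_def)
  define m where "m = n - 1"
  have n: "n = Suc m" using card fin ne card_gt_0_iff[of Orb] by (simp add: m_def)
  define x where "x i = sorted_list_of_set Orb ! i" for i
  have len: "length (sorted_list_of_set Orb) = Suc m"
    using card n fin by simp
  have mono: "strict_mono_on {..<Suc m} x"
    using sorted_wrt_nth_less[OF strict_sorted_list_of_set[of Orb]] len
    by (auto simp: x_def intro!: strict_mono_onI)
  have Orb: "x ` {..<Suc m} = Orb"
    using fin len set_conv_nth[of "sorted_list_of_set Orb"] by (auto simp: x_def)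
  have bij: "bij_betw x {..<Suc m} Orb"
    using Orb strict_mono_on_imp_inj_on[OF mono] by (simp add: bij_betw_def)
  \<comment> \<open>\<open>f\<close> maps the finite set \<open>Orb\<close> onto itself, hence injectively.\<close>
  have "Orb \<subseteq> f ` Orb"
  proof
    fix t assume t: "t \<in> Orb"
    then have "t \<in> orbit f t" using orbit_cyclic_eq3[OF cyc t] by simp
    then show "t \<in> f ` Orb"
    proof cases
      case base then show ?thesis using t by auto
    next
      case (step u) then show ?thesis using orbit_cyclic_eq3[OF cyc t] by auto
    qed
  qed
  then have f_inj: "inj_on f Orb"
    using fin by (meson endo_inj_surj finite_surj_inj)
  define \<pi> where "\<pi> i = the_inv_into {..<Suc m} x (f (x i))" for i
  have x_inj: "inj_on x {..m}" using bij by (auto simp: bij_betw_def lessThan_Suc_atMost)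
  have \<pi>: "\<pi> i \<le> m" "x (\<pi> i) = f (x i)" if "i \<le> m" for i
  proof -
    have "f (x i) \<in> x ` {..<Suc m}" using that Orb cyclic_on_inI[OF cyc] by auto
    then show "\<pi> i \<le> m" "x (\<pi> i) = f (x i)"
      using the_inv_into_into[OF bij_betw_imp_inj_on[OF bij], of "f (x i)" "{..<Suc m}"]
        f_the_inv_into_f[OF bij_betw_imp_inj_on[OF bij]] by (auto simp: \<pi>_def)
  qed
  have "inj_on \<pi> {..m}"
  proof (rule inj_onI)
    fix i j assume ij: "i \<in> {..m}" "j \<in> {..m}" "\<pi> i = \<pi> j"
    then have "f (x i) = f (x j)" using \<pi>(2) by (metis atMost_iff)
    then have "x i = x j" using f_inj ij Orb by (auto simp: inj_on_def)
    then show "i = j" using x_inj ij by (auto simp: inj_on_def)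
  qed
  moreover have "\<pi> ` {..m} \<subseteq> {..m}" using \<pi>(1) by auto
  ultimately obtain \<sigma> where \<sigma>: "\<sigma> permutes {..<m}"
    and cross: "\<And>i. i < m \<Longrightarrow> crossing (\<pi> i) (\<pi> (Suc i)) (\<sigma> i) \<noteq> 0"
    using crossing_gap_permutation by blast
  have \<sigma>_less: "\<sigma> i < m" if "i < m" for i using permutes_in_image[OF \<sigma>, of i] that by simp
  have le: "x p \<le> x q" if "p \<le> q" "q \<le> m" for p q
    using strict_mono_on_leD[OF mono, of p q] that by auto
  have in_Orb: "x i \<in> Orb" if "i \<le> m" for i
    using that unfolding Orb[symmetric] by simp
  have in01: "x i \<in> {0..1}" if "i \<le> m" for i
    using in_Orb[OF that] assms(3) by blast
  obtain y where y: "\<And>i. i < m \<Longrightarrow> y i \<in> {x i..x (Suc i)}"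
    and fy: "\<And>i. i < m \<Longrightarrow> f (y i) = y (\<sigma> i)"
  proof (rule permutation_of_intervals[OF \<sigma>, of x "\<lambda>i. x (Suc i)" f])
    fix i assume "i \<in> {..<m}"
    then have i: "i < m" by simp
    show "x i \<le> x (Suc i)" using le i by simp
    show "continuous_on {x i..x (Suc i)} f"
      using in01[of i] in01[of "Suc i"] i by (intro continuous_on_subset[OF assms(1)]) auto
    have "\<pi> i \<le> \<sigma> i \<and> Suc (\<sigma> i) \<le> \<pi> (Suc i) \<or> \<pi> (Suc i) \<le> \<sigma> i \<and> Suc (\<sigma> i) \<le> \<pi> i"
      using cross[OF i] by (auto simp: crossing_nonzero_iff)
    then have "x (\<pi> i) \<le> x (\<sigma> i) \<and> x (Suc (\<sigma> i)) \<le> x (\<pi> (Suc i)) \<or>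
        x (\<pi> (Suc i)) \<le> x (\<sigma> i) \<and> x (Suc (\<sigma> i)) \<le> x (\<pi> i)"
    proof (elim disj_forward conj_forward)
    qed (use le \<pi>(1)[of i] \<pi>(1)[of "Suc i"] \<sigma>_less[OF i] i in simp_all)
    then have "f (x i) \<le> x (\<sigma> i) \<and> x (Suc (\<sigma> i)) \<le> f (x (Suc i)) \<or>
        f (x (Suc i)) \<le> x (\<sigma> i) \<and> x (Suc (\<sigma> i)) \<le> f (x i)"
      using \<pi>(2)[of i] \<pi>(2)[of "Suc i"] i by simp
    then show "{x (\<sigma> i)..x (Suc (\<sigma> i))} \<subseteq> closed_segment (f (x i)) (f (x (Suc i)))"
      by (auto simp: closed_segment_eq_real_ivl)
  qed auto
  define S where "S = y ` {..<m}"
  have fS: "f ` S = S"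
  proof -
    have "f ` S = y ` \<sigma> ` {..<m}"
      unfolding S_def image_image by (intro image_cong refl fy) simp
    then show ?thesis using permutes_image[OF \<sigma>] by (simp add: S_def)
  qed
  \<comment> \<open>An orbit point among the \<open>y i\<close> would drag all \<open>m + 1\<close> points of \<open>Orb\<close> into \<open>S\<close>.\<close>
  have disjoint: "y i \<notin> Orb" if i: "i < m" for i
  proof
    assume "y i \<in> Orb"
    then have eq: "Orb = orbit f (y i)" using orbit_cyclic_eq3[OF cyc] by simp
    have start: "y i \<in> S" using i by (simp add: S_def)
    have step: "f t \<in> S" if "t \<in> S" for t using imageI[OF that, of f] unfolding fS .
    have "t \<in> S" if "t \<in> orbit f (y i)" for t
      using that by (induction rule: orbit.induct) (auto intro: start step)
    then have "card Orb \<le> card S" unfolding eq by (intro card_mono) (auto simp: S_def)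
    also have "\<dots> \<le> m" using card_image_le[of "{..<m}" y] by (simp add: S_def)
    finally show False using card n by simp
  qed
  have strict: "x i < y i" "y i < x (Suc i)" if i: "i < m" for i
  proof -
    have "y i \<noteq> x i" "y i \<noteq> x (Suc i)"
      using disjoint[OF i] in_Orb[of i] in_Orb[of "Suc i"] i by auto
    then show "x i < y i" "y i < x (Suc i)" using y[OF i] by auto
  qed
  have "S \<subseteq> {0..1}"
  proof
    fix t assume "t \<in> S"
    then obtain i where "i < m" "t = y i" by (auto simp: S_def)
    then show "t \<in> {0..1}" using y[of i] in01[of i] in01[of "Suc i"] by auto
  qed
  moreover have "finite S" by (simp add: S_def)
  moreover have "bij_betw f S S"
    using fS \<open>finite S\<close> by (simp add: bij_betw_def finite_surj_inj)
  moreover have "card S = n - 1" "interwinds S Orb"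
    using interleaved_interwinds[OF strict mono] Orb n by (auto simp: S_def)
  ultimately show ?thesis by blast
qed

end
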